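(* Let $\{0,\dots,N-1\}$ be a finite data set with distance function $\mathrm{Dist}$, let $b>0$ be the linking length, and let $H[0:N]$ be the array output by the friends-of-friends algorithm by pair enumeration with splay (described in the context). Then the features in $H$ are fully connected and maximum: for all points $i,j$, $H[i]=H[j]$ if and only if $i$ and $j$ are connected by a path, i.e. there exist $k\ge 0$ and points $i=i_0,i_1,\dots,i_k=j$ of the data set with $\mathrm{Dist}(i_{t-1},i_t)<b$ for all $1\le t\le k$.
   Context: Setting. The data set consists of $N$ points indexed by $0,\dots,N-1$, with a distance function (metric) $\mathrm{Dist}(i,j)$; $b>0$ is the linking length. Forest of proto-features. An array $H[0:N]$ with values in $\{0,\dots,N-1\}$ represents a forest: $H[i]=p$ means $p$ is the parent of $i$, and $r$ is a root iff $H[r]=r$. $\mathrm{root}(i)$ denotes the root reached by following parents from $i$. Operations. $\mathrm{splay}(H,i)$: set $r\leftarrow i$; while $H[r]\ne r$, set $r\leftarrow H[r]$; then set $H[i]\leftarrow r$ (optionally, as a "safe guard", also set $H[k]\leftarrow r$ for every $k$ on the path followed from $i$ to $r$), and return $r$. $\mathrm{merge}(H,i,j)$: set $r\leftarrow \mathrm{splay}(H,i)$, then $s\leftarrow\mathrm{splay}(H,j)$, then $H[r]\leftarrow s$. Pair enumeration. The algorithm uses a pair enumeration procedure (implemented in the paper by simultaneously walking two copies of a KD-tree) which yields, one after another and in some order, all pairs of data points within the linking length: every yielded pair $(i,j)$ satisfies $\mathrm{Dist}(i,j)<b$, and for all $i\neq j$ with $\mathrm{Dist}(i,j)<b$ at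 least one of $(i,j)$, $(j,i)$ is yielded. The algorithm. (1) Initialize $H[i]\leftarrow i$ for all $i$. (2) For each pair $(i,j)$ yielded by the pair enumeration, in the order yielded, perform $\mathrm{merge}(H,i,j)$. (3) For $i=0,\dots,N-1$ perform $\mathrm{splay}(H,i)$. The output is the resulting $H$; its features are the sets of points sharing a common value of $H$. *)

theory Defs
  imports
    "HOL-Analysis.Abstract_Metric_Spaces"
    "HOL-Library.While_Combinator"
    "HOL-Library.Monad_Syntax"
begin

text \<open>
  The array $H[0:N]$ is a list of length $N$. Programs return an \<^typ>\<open>'a option\<close>, where
  \<^const>\<open>None\<close> means that some while loop does not terminate.
\<close>

text \<open>
  The loop of \<open>splay\<close>: the root \<open>r\<close> reached from \<open>i\<close>, together with the nodes visited strictly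
  before \<open>r\<close>.
\<close>

definition walk :: "nat list \<Rightarrow> nat \<Rightarrow> (nat \<times> nat list) option" where
  "walk H i = while_option (\<lambda>(r, ks). H ! r \<noteq> r) (\<lambda>(r, ks). (H ! r, r # ks)) (i, [])"

text \<open>
  The flag \<open>guard\<close> selects the variant with the optional safe guard. The root \<open>r\<close> is not among
  the \<open>ks\<close>, but already satisfies \<open>H ! r = r\<close>.
\<close>

definition splay :: "bool \<Rightarrow> nat list \<Rightarrow> nat \<Rightarrow> (nat list \<times> nat) option" where
  "splay guard H i = do {
     (r, ks) \<leftarrow> walk H i;
     let H' = H[i := r];
     Some (if guard then fold (\<lambda>k G. G[k := r]) ks H' else H', r)
   }"

definition merge_trees :: "bool \<Rightarrow> nat list \<Rightarrow> nat \<Rightarrow> nat \<Rightarrow> nat list option" where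
  "merge_trees guard H i j = do {
     (H, r) \<leftarrow> splay guard H i;
     (H, s) \<leftarrow> splay guard H j;
     Some (H[r := s])
   }"

primrec for_each :: "('a \<Rightarrow> 's \<Rightarrow> 's option) \<Rightarrow> 'a list \<Rightarrow> 's \<Rightarrow> 's option" where
  "for_each f [] s = Some s"
| "for_each f (x # xs) s = do { s' \<leftarrow> f x s; for_each f xs s' }"

definition friends_of_friends :: "bool \<Rightarrow> nat \<Rightarrow> (nat \<times> nat) list \<Rightarrow> nat list option" where
  "friends_of_friends guard N ps = do {
     H \<leftarrow> for_each (\<lambda>(i, j) H. merge_trees guard H i j) ps [0..<N];
     for_each (\<lambda>i H. do { (H', r) \<leftarrow> splay guard H i; Some H' }) [0..<N] H
   }"

text \<open>
  \<open>ps\<close> lists the pairs in the order yielded; repetitions and pairs $(i,i)$ are permitted.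
\<close>

definition pair_enumeration ::
    "nat \<Rightarrow> (nat \<Rightarrow> nat \<Rightarrow> real) \<Rightarrow> real \<Rightarrow> (nat \<times> nat) list \<Rightarrow> bool" where
  "pair_enumeration N Dist b ps \<longleftrightarrow>
     (\<forall>(i, j) \<in> set ps. i < N \<and> j < N \<and> Dist i j < b) \<and>
     (\<forall>i<N. \<forall>j<N. i \<noteq> j \<and> Dist i j < b \<longrightarrow> (i, j) \<in> set ps \<or> (j, i) \<in> set ps)"

definition path_connected_points ::
    "nat \<Rightarrow> (nat \<Rightarrow> nat \<Rightarrow> real) \<Rightarrow> real \<Rightarrow> nat \<Rightarrow> nat \<Rightarrow> bool" where
  "path_connected_points N Dist b i j \<longleftrightarrow>
     (\<exists>k::nat. \<exists>p :: nat \<Rightarrow> nat. p 0 = i \<and> p k = j \<and> (\<forall>t\<le>k. p t < N) \<and>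
        (\<forall>t. 1 \<le> t \<and> t \<le> k \<longrightarrow> Dist (p (t - 1)) (p t) < b))"

end

theory Submission imports Defs begin

text \<open>
  Throughout the run, every tree of \<open>H\<close> is labelled by its root through a function \<open>f\<close>, and a rank
  \<open>d\<close> that strictly decreases towards the parent makes the walks terminate. A splay leaves \<open>f\<close> and
  \<open>d\<close> valid, while merging \<open>i\<close> and \<open>j\<close> relabels the tree of \<open>i\<close> by \<open>f j\<close>. Hence points with equal
  labels stay equal, endpoints of processed pairs get equal labels, and only connected points are
  ever identified. The final splays make \<open>H\<close> coincide with \<open>f\<close>.
\<close>

text \<open>The root map \<open>f\<close> is a parameter because following parents is only a partial
  operation. The rank \<open>d\<close> is arbitrary rather than the depth, so it stays valid when a
  splay shortens paths.\<close>

definition rooted_forest :: "nat list \<Rightarrow> (nat \<Rightarrow> nat) \<Rightarrow> (nat \<Rightarrow> nat) \<Rightarrow> bool" where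
  "rooted_forest H f d \<longleftrightarrow> (\<forall>i<length H. H ! i < length H \<and> f i < length H \<and>
     f (H ! i) = f i \<and> H ! f i = f i \<and> (H ! i = i \<longrightarrow> f i = i) \<and> (H ! i \<noteq> i \<longrightarrow> d (H ! i) < d i))"

lemma rooted_forestD:
  assumes "rooted_forest H f d" "i < length H"
  shows "H ! i < length H" "f i < length H" "f (H ! i) = f i" "H ! f i = f i"
    "H ! i = i \<Longrightarrow> f i = i" "H ! i \<noteq> i \<Longrightarrow> d (H ! i) < d i"
  using assms unfolding rooted_forest_def by blast+

lemma root_idem:
  assumes "rooted_forest H f d" "i < length H"
  shows "f (f i) = f i"
  using rooted_forestD[OF assms] rooted_forestD(5)[OF assms(1)] by blast

text \<open>The decreases along the parent chain add up. This allows a pointer to jump straight to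
  its root without changing \<open>d\<close>.\<close>

lemma rank_root_less:
  assumes "rooted_forest H f d" "i < length H" "f i \<noteq> i"
  shows "d (f i) < d i"
  using assms(2,3)
proof (induction "d i" arbitrary: i rule: less_induct)
  case less
  note F = rooted_forestD[OF assms(1) less.prems(1)]
  have lt: "d (H ! i) < d i"
    using F less.prems by blast
  show ?case
  proof (cases "f i = H ! i")
    case True
    then show ?thesis using lt by simp
  next
    case False
    then have "d (f (H ! i)) < d (H ! i)"
      using less.hyps[OF lt] F by simp
    then show ?thesis using lt F(3) by simp
  qed
qed

lemma rooted_forest_update:
  assumes F: "rooted_forest H f d" and k: "k < length H"
  shows "rooted_forest (H[k := f k]) f d"
proof -
  have idem: "f (f i) = f i" if "i < length H" for i
    using root_idem[OF F that] .
  show ?thesis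
    unfolding rooted_forest_def
    using rooted_forestD[OF F] rank_root_less[OF F k] idem[OF k] k
    by (auto simp: nth_list_update)
qed

text \<open>Each write of the safe guard redirects a node to its own root, which changes neither
  labels nor ranks. The last conjunct ensures that flattened entries remain flat during later
  splays.\<close>

lemma rooted_forest_updates:
  assumes "rooted_forest H f d" and "\<forall>k\<in>set ks. k < length H \<and> f k = r"
  shows "rooted_forest (fold (\<lambda>k G. G[k := r]) ks H) f d \<and>
    length (fold (\<lambda>k G. G[k := r]) ks H) = length H \<and>
    (\<forall>j<length H. H ! j = f j \<longrightarrow> fold (\<lambda>k G. G[k := r]) ks H ! j = f j)"
  using assms
proof (induction ks arbitrary: H)
  case (Cons k ks)
  have "rooted_forest (H[k := r]) f d"
    using rooted_forest_update[OF Cons.prems(1), of k] Cons.prems(2) by auto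
  from Cons.IH[OF this] Cons.prems(2) show ?case
    by (auto simp: nth_list_update)
qed simp

text \<open>The rank of the current node drops at every step, so induction on \<open>d r\<close>
  gives termination. The accumulator \<open>ks\<close> is arbitrary because each step extends it;
  the inclusion shows that all visited nodes share one root, as the safe guard requires.\<close>

lemma walk_loop:
  assumes "rooted_forest H f d" "r < length H"
  shows "\<exists>ks'. while_option (\<lambda>(r, ks). H ! r \<noteq> r) (\<lambda>(r, ks). (H ! r, r # ks)) (r, ks) = Some (f r, ks') \<and>
    set ks' \<subseteq> set ks \<union> {k. k < length H \<and> f k = f r}"
  using assms(2)
proof (induction "d r" arbitrary: r ks rule: less_induct)
  case less
  note F = rooted_forestD[OF assms(1) less.prems]
  show ?case
  proof (cases "H ! r = r")
    case True
    then show ?thesis using F(5) by (subst while_option_unfold) auto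
  next
    case False
    from less.hyps[OF F(6)[OF False] F(1), of "r # ks"] show ?thesis
      using False F(3) less.prems by (subst while_option_unfold) auto
  qed
qed

lemma walk_rooted_forest:
  assumes "rooted_forest H f d" "i < length H"
  obtains ks where "walk H i = Some (f i, ks)" "\<forall>k\<in>set ks. k < length H \<and> f k = f i"
  using walk_loop[OF assms, of "[]"] unfolding walk_def by auto

lemma splay_rooted_forest:
  assumes F: "rooted_forest H f d" and i: "i < length H"
  obtains H' where "splay guard H i = Some (H', f i)" "rooted_forest H' f d"
    "length H' = length H" "H' ! i = f i" "\<forall>j<length H. H ! j = f j \<longrightarrow> H' ! j = f j"
proof -
  obtain ks where ks: "walk H i = Some (f i, ks)" "\<forall>k\<in>set ks. k < length H \<and> f k = f i"
    using walk_rooted_forest[OF F i] .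
  let ?G = "H[i := f i]"
  let ?H = "if guard then fold (\<lambda>k G. G[k := f i]) ks ?G else ?G"
  have G: "rooted_forest ?G f d"
    using rooted_forest_update[OF F i] .
  have "rooted_forest ?H f d \<and> length ?H = length ?G \<and>
      (\<forall>j<length ?G. ?G ! j = f j \<longrightarrow> ?H ! j = f j)"
    using rooted_forest_updates[OF G, of ks "f i"] G ks(2) by simp
  then show thesis
    using i by (intro that[of ?H]) (simp_all add: splay_def ks(1) nth_list_update Let_def)
qed

lemma rooted_forest_link:
  assumes F: "rooted_forest H f d" and i: "i < length H" and j: "j < length H"
  obtains d' where "rooted_forest (H[f i := f j]) (\<lambda>x. if f x = f i then f j else f x) d'"
proof (cases "f i = f j")
  case True
  have "H[f i := f j] = H"
    using True rooted_forestD(4)[OF F i] list_update_id[of H "f i"] by simp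
  moreover have "(\<lambda>x. if f x = f i then f j else f x) = f"
    using True by auto
  ultimately show ?thesis using that F by simp
next
  case False
  \<comment> \<open>Lifting the whole tree of \<open>i\<close> by a constant keeps its inner edges
    descending and puts its root \<open>f i\<close> above \<open>f j\<close>, so the new edge
    descends too.\<close>
  let ?d = "\<lambda>x. if f x = f i then d x + d (f j) + 1 else d x"
  have "rooted_forest (H[f i := f j]) (\<lambda>x. if f x = f i then f j else f x) ?d"
    unfolding rooted_forest_def
    using rooted_forestD[OF F] root_idem[OF F] i j False
    by (auto simp: nth_list_update)
  then show ?thesis using that by blast
qed

lemma merge_rooted_forest:
  assumes F: "rooted_forest H f d" and i: "i < length H" and j: "j < length H"
  obtains H' d' where "merge_trees guard H i j = Some H'" "length H' = length H"
    "rooted_forest H' (\<lambda>x. if f x = f i then f j else f x) d'"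
proof -
  obtain H1 where H1: "splay guard H i = Some (H1, f i)" "rooted_forest H1 f d"
      "length H1 = length H"
    using splay_rooted_forest[OF F i] by metis
  obtain H2 where H2: "splay guard H1 j = Some (H2, f j)" "rooted_forest H2 f d"
      "length H2 = length H1"
    using splay_rooted_forest[OF H1(2)] j H1(3) by metis
  obtain d' where "rooted_forest (H2[f i := f j]) (\<lambda>x. if f x = f i then f j else f x) d'"
    using rooted_forest_link[OF H2(2)] i j H1(3) H2(3) by metis
  then show thesis
    using that H1 H2 by (simp add: merge_trees_def)
qed

text \<open>\<open>C\<close> stands for reachability. Preservation of equal labels from
  \<open>f\<close> to \<open>f'\<close> is what carries the effect of one merge through all later
  ones.\<close>

lemma for_each_merge:
  assumes "rooted_forest H f d"
    and "\<forall>(i, j)\<in>set ps. i < length H \<and> j < length H \<and> C i j"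
    and "symp C" "transp C"
    and "\<forall>x<length H. \<forall>y<length H. f x = f y \<longrightarrow> C x y"
  shows "\<exists>H' f' d'. for_each (\<lambda>(i, j) H. merge_trees guard H i j) ps H = Some H' \<and>
    length H' = length H \<and> rooted_forest H' f' d' \<and> (\<forall>(i, j)\<in>set ps. f' i = f' j) \<and>
    (\<forall>x y. f x = f y \<longrightarrow> f' x = f' y) \<and>
    (\<forall>x<length H. \<forall>y<length H. f' x = f' y \<longrightarrow> C x y)"
  using assms(1,2,5)
proof (induction ps arbitrary: H f d)
  case Nil
  then show ?case by auto
next
  case (Cons p ps)
  obtain i j where p: "p = (i, j)" by fastforce
  have ij: "i < length H" "j < length H" "C i j"
    using Cons.prems(2) p by auto
  let ?g = "\<lambda>x. if f x = f i then f j else f x"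
  obtain H1 d1 where H1: "merge_trees guard H i j = Some H1" "length H1 = length H"
      "rooted_forest H1 ?g d1"
    using merge_rooted_forest[OF Cons.prems(1) ij(1,2)] .
  have sym: "C x y \<Longrightarrow> C y x" and trans: "C x y \<Longrightarrow> C y z \<Longrightarrow> C x z" for x y z
    using assms(3,4) by (blast dest: sympD transpD)+
  have "C x y" if xy: "x < length H" "y < length H" and g: "?g x = ?g y" for x y
  proof -
    have eq: "C u v" if "u < length H" "v < length H" "f u = f v" for u v
      using Cons.prems(3) that by blast
    \<comment> \<open>Either the old labels agree, or one point lies in the tree of \<open>i\<close>
      and the other in that of \<open>j\<close>. The pair \<open>(i, j)\<close> then bridges the two
      trees, traversed backwards in the last case.\<close>
    consider "f x = f y" | "f x = f i" "f j = f y" | "f x = f j" "f i = f y"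
      using g by (metis (full_types))
    then show ?thesis
    proof cases
      case 1
      then show ?thesis using eq xy by blast
    next
      case 2
      then have "C x i" "C j y" using eq xy ij by blast+
      then show ?thesis using ij(3) trans by blast
    next
      case 3
      then have "C x j" "C i y" using eq xy ij by blast+
      then show ?thesis using sym[OF ij(3)] trans by blast
    qed
  qed
  then have g: "\<forall>x<length H1. \<forall>y<length H1. ?g x = ?g y \<longrightarrow> C x y"
    unfolding H1(2) by blast
  have ps: "\<forall>(i, j)\<in>set ps. i < length H1 \<and> j < length H1 \<and> C i j"
    using Cons.prems(2) H1(2) by simp
  obtain H' f' d' where H': "for_each (\<lambda>(i, j) H. merge_trees guard H i j) ps H1 = Some H'"
      "length H' = length H" "rooted_forest H' f' d'" "\<forall>(i, j)\<in>set ps. f' i = f' j"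
      "\<forall>x y. ?g x = ?g y \<longrightarrow> f' x = f' y"
      "\<forall>x<length H. \<forall>y<length H. f' x = f' y \<longrightarrow> C x y"
    using Cons.IH[OF H1(3) ps g] unfolding H1(2) by blast
  \<comment> \<open>Both endpoints have \<open>?g\<close>-label \<open>f j\<close> after this merge,
    and later merges keep equal labels equal.\<close>
  have "f' i = f' j"
    using H'(5) by simp
  then have edges: "\<forall>(i, j)\<in>set (p # ps). f' i = f' j"
    using H'(4) p by simp
  have "f' x = f' y" if "f x = f y" for x y
    by (intro H'(5)[rule_format]) (simp only: that)
  moreover have "for_each (\<lambda>(i, j) H. merge_trees guard H i j) (p # ps) H = Some H'"
    using H'(1) H1(1) p by simp
  ultimately show ?case
    using H'(2,3,6) edges by blast
qed

text \<open>The disjunct \<open>H ! i = f i\<close> makes the induction go through: an entry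
  flattened by the first splay need not occur in the remaining list.\<close>

lemma for_each_splay:
  assumes "rooted_forest H f d" and "\<forall>i\<in>set is. i < length H"
  shows "\<exists>H'. for_each (\<lambda>i H. do { (H', r) \<leftarrow> splay guard H i; Some H' }) is H = Some H' \<and>
    length H' = length H \<and> (\<forall>i<length H. H ! i = f i \<or> i \<in> set is \<longrightarrow> H' ! i = f i)"
  using assms
proof (induction "is" arbitrary: H)
  case (Cons i "is")
  have "i < length H"
    using Cons.prems(2) by simp
  from splay_rooted_forest[OF Cons.prems(1) this] obtain H1 where H1:
      "splay guard H i = Some (H1, f i)" "rooted_forest H1 f d" "length H1 = length H"
      "H1 ! i = f i" "\<forall>j<length H. H ! j = f j \<longrightarrow> H1 ! j = f j"
    by metis
  with Cons.IH[OF H1(2)] Cons.prems(2) show ?case by auto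
qed simp

text \<open>The conjunct \<open>i < N\<close> excludes the empty path at a point outside the data
  set, which the reflexive closure admits.\<close>

lemma path_connected_points_iff_rtranclp:
  "path_connected_points N Dist b i j \<longleftrightarrow>
     i < N \<and> (\<lambda>x y. x < N \<and> y < N \<and> Dist x y < b)\<^sup>*\<^sup>* i j" (is "?L \<longleftrightarrow> i < N \<and> ?E\<^sup>*\<^sup>* i j")
proof
  assume ?L
  then obtain k :: nat and p where p: "p 0 = i" "p k = j" "\<forall>t\<le>k. p t < N"
      "\<forall>t. 1 \<le> t \<and> t \<le> k \<longrightarrow> Dist (p (t - 1)) (p t) < b"
    unfolding path_connected_points_def by auto
  have "?E (p t) (p (Suc t))" if "t < k" for t
    using p(3) p(4)[rule_format, of "Suc t"] that by simp
  then have "(?E ^^ k) i j"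
    using p(1,2) by (auto simp: relpowp_fun_conv)
  then show "i < N \<and> ?E\<^sup>*\<^sup>* i j"
    using p(1,3) by (auto dest: relpowp_imp_rtranclp)
next
  assume R: "i < N \<and> ?E\<^sup>*\<^sup>* i j"
  then obtain k where "(?E ^^ k) i j"
    by (blast dest: rtranclp_imp_relpowp)
  then obtain p where p: "p 0 = i" "p k = j" "\<forall>t<k. ?E (p t) (p (Suc t))"
    by (auto simp: relpowp_fun_conv)
  have "p t < N" if "t \<le> k" for t
    using p R that by (cases t) auto
  moreover have "Dist (p (t - 1)) (p t) < b" if "1 \<le> t" "t \<le> k" for t
    using p(3)[rule_format, of "t - 1"] that by simp
  ultimately show ?L
    unfolding path_connected_points_def using p(1,2) by blast
qed

theorem theorem2:
  fixes N :: nat and Dist :: "nat \<Rightarrow> nat \<Rightarrow> real" and b :: real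
    and ps :: "(nat \<times> nat) list" and guard :: bool
  assumes "Metric_space {..<N} Dist"
    and "b > 0"
    and "pair_enumeration N Dist b ps"
  shows "\<exists>H. friends_of_friends guard N ps = Some H \<and> length H = N \<and>
    (\<forall>i<N. \<forall>j<N. H ! i = H ! j \<longleftrightarrow> path_connected_points N Dist b i j)"
proof -
  define E where "E = (\<lambda>x y. x < N \<and> y < N \<and> Dist x y < b)"
  have "symp E"
    using Metric_space.commute[OF assms(1)] by (auto simp: E_def symp_def)
  then have "symp E\<^sup>*\<^sup>*"
    by (rule symp_rtranclp)
  \<comment> \<open>Initially every point is its own root, so there is no edge along which the rank
    must decrease.\<close>
  moreover have "rooted_forest [0..<N] id id"
    by (simp add: rooted_forest_def)
  moreover have "\<forall>(i, j)\<in>set ps. i < N \<and> j < N \<and> E\<^sup>*\<^sup>* i j"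
    using assms(3) by (auto simp: pair_enumeration_def E_def)
  ultimately obtain H f d where H:
      "for_each (\<lambda>(i, j) H. merge_trees guard H i j) ps [0..<N] = Some H" "length H = N"
      "rooted_forest H f d" "\<forall>(i, j)\<in>set ps. f i = f j"
      "\<forall>x<N. \<forall>y<N. f x = f y \<longrightarrow> E\<^sup>*\<^sup>* x y"
    using for_each_merge[of "[0..<N]" id id ps "E\<^sup>*\<^sup>*" guard] by auto
  \<comment> \<open>The enumeration promises only pairs of distinct points in one orientation;
    equality of labels supplies the diagonal and the reverse orientation.\<close>
  have edge: "f x = f y" if "E x y" for x y
    using assms(3) H(4) that unfolding pair_enumeration_def E_def by (cases "x = y") fastforce+
  have reach: "f x = f y" if "E\<^sup>*\<^sup>* x y" for x y
    using that by induction (simp_all add: edge)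
  obtain H' where H': "friends_of_friends guard N ps = Some H'" "length H' = N"
      "\<forall>i<N. H' ! i = f i"
    using for_each_splay[OF H(3), of "[0..<N]" guard] H(1,2)
    by (auto simp: friends_of_friends_def)
  have "H' ! i = H' ! j \<longleftrightarrow> E\<^sup>*\<^sup>* i j" if "i < N" "j < N" for i j
    using H(5) H'(3) reach that by metis
  then show ?thesis
    using H' by (auto simp: path_connected_points_iff_rtranclp E_def)
qed

end
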